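(* Let $\mu>0$. (A) If $\lambda>0$, $h=-\frac{3}{20}\lambda$ and $V_0=\frac{3\mu^4}{\lambda}$, then $$V\ge0\ \text{ on }\mathfrak h_0(5),\qquad V^{-1}(0)=\Sigma_A^-\cup\Sigma_A^+ .$$ (B) If $h>0$, $\lambda=-\frac{10}{9}h$ and $V_0=\frac{9\mu^4}{10h}$, then $$V\ge0\ \text{ on }\mathfrak h_0(5),\qquad V^{-1}(0)=\Sigma_B^-\cup\Sigma_B^+ .$$ In both cases the two components ($\Sigma_A^-$ and $\Sigma_A^+$, respectively $\Sigma_B^-$ and $\Sigma_B^+$) are compact, connected, and disjoint.
   Context: Let $\mathfrak h_0(5)=\{Q\in\mathbb C^{5\times5}:Q^\dagger=Q,\ \operatorname{Tr}Q=0\}$ with norm $\lVert A\rVert_F=(\operatorname{Tr}(A^2))^{1/2}$. The potential is $$V(\Phi)=-\mu^2\operatorname{Tr}(\Phi^2)+h\bigl(\operatorname{Tr}(\Phi^2)\bigr)^2+\lambda\operatorname{Tr}(\Phi^4)+V_0,\qquad\Phi\in\mathfrak h_0(5).$$ In case (A) set $u=\frac{\sqrt5\,\mu}{5\sqrt\lambda}$, $\Phi_A^+=u\operatorname{diag}(3,3,-2,-2,-2)$, $\Phi_A^-=u\operatorname{diag}(2,2,-3,-3,2)$. In case (B) set $v=\frac{3\mu}{10\sqrt h}$, $\Phi_B^+=v\operatorname{diag}(1,1,1,1,-4)$, $\Phi_B^-=v\operatorname{diag}(-1,-1,-1,4,-1)$. For $\ast\in\{A,B\}$, $\Sigma_\ast^\pm=\{U^\dagger\Phi_\ast^\pm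 U:U\in\operatorname{SU}(5)\}$. *)

theory Defs
  imports "HOL-Analysis.Analysis"
begin

definition adjoint_matrix :: "complex^'n^'m \<Rightarrow> complex^'m^'n" where
  "adjoint_matrix A = map_matrix cnj (transpose A)"

definition diagonal_matrix :: "'a::zero^'n \<Rightarrow> 'a^'n^'n" where
  "diagonal_matrix d = (\<chi> i j. if i = j then d $ i else 0)"

definition special_unitary :: "(complex^'n^'n) set" where
  "special_unitary = {U. adjoint_matrix U ** U = mat 1 \<and> det U = 1}"

definition traceless_hermitian :: "(complex^'n^'n) set" where
  "traceless_hermitian = {Q. adjoint_matrix Q = Q \<and> trace Q = 0}"

text \<open>
  Powers of matrices are written with \<^term>\<open>(**)\<close>, because \<^term>\<open>(*)\<close> acts entrywise on
  vectors. The traces of powers of a Hermitian matrix are real, so taking real parts only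
  adjusts the type.
\<close>

definition potential :: "real \<Rightarrow> real \<Rightarrow> real \<Rightarrow> real \<Rightarrow> complex^'n^'n \<Rightarrow> real" where
  "potential mu h lam V0 \<Phi> =
     - mu\<^sup>2 * Re (trace (\<Phi> ** \<Phi>)) + h * (Re (trace (\<Phi> ** \<Phi>)))\<^sup>2
     + lam * Re (trace (\<Phi> ** \<Phi> ** \<Phi> ** \<Phi>)) + V0"

definition unitary_orbit :: "complex^'n^'n \<Rightarrow> (complex^'n^'n) set" where
  "unitary_orbit \<Phi> = {adjoint_matrix U ** \<Phi> ** U | U. U \<in> special_unitary}"

definition PhiA_plus :: "real \<Rightarrow> real \<Rightarrow> complex^5^5" where
  "PhiA_plus mu lam =
     (sqrt 5 * mu / (5 * sqrt lam)) *\<^sub>R diagonal_matrix (vector [3, 3, -2, -2, -2])"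

definition PhiA_minus :: "real \<Rightarrow> real \<Rightarrow> complex^5^5" where
  "PhiA_minus mu lam =
     (sqrt 5 * mu / (5 * sqrt lam)) *\<^sub>R diagonal_matrix (vector [2, 2, -3, -3, 2])"

definition PhiB_plus :: "real \<Rightarrow> real \<Rightarrow> complex^5^5" where
  "PhiB_plus mu h =
     (3 * mu / (10 * sqrt h)) *\<^sub>R diagonal_matrix (vector [1, 1, 1, 1, -4])"

definition PhiB_minus :: "real \<Rightarrow> real \<Rightarrow> complex^5^5" where
  "PhiB_minus mu h =
     (3 * mu / (10 * sqrt h)) *\<^sub>R diagonal_matrix (vector [-1, -1, -1, 4, -1])"

lemma vector_5 [simp]:
  "(vector [a, b, c, d, e] :: 'a::zero^5) $ 1 = a"
  "(vector [a, b, c, d, e] :: 'a::zero^5) $ 2 = b"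
  "(vector [a, b, c, d, e] :: 'a::zero^5) $ 3 = c"
  "(vector [a, b, c, d, e] :: 'a::zero^5) $ 4 = d"
  "(vector [a, b, c, d, e] :: 'a::zero^5) $ 5 = e"
  unfolding vector_def by simp_all

text \<open>
  The library norm on matrices restricts to the Frobenius norm on traceless Hermitian
  matrices, so compactness and connectedness refer to the Frobenius topology.
\<close>

lemma norm_eq_frobenius:
  assumes "A \<in> traceless_hermitian"
  shows "norm A = sqrt (Re (trace (A ** A)))"
proof -
  have adj: "A $ j $ i = cnj (A $ i $ j)" for i j
    using assms
    by (auto simp: traceless_hermitian_def adjoint_matrix_def map_matrix_def transpose_def vec_eq_iff)
  have entry: "(cmod (A $ i $ j))\<^sup>2 = Re (A $ i $ j * A $ j $ i)" for i j
    unfolding adj[of j i] by (simp add: cmod_power2 flip: power2_eq_square)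
  have "(norm A)\<^sup>2 = (\<Sum>i\<in>UNIV. \<Sum>j\<in>UNIV. (cmod (A $ i $ j))\<^sup>2)"
    by (simp add: norm_vec_def L2_set_def sum_nonneg)
  also have "\<dots> = (\<Sum>i\<in>UNIV. \<Sum>j\<in>UNIV. Re (A $ i $ j * A $ j $ i))"
    by (simp only: entry)
  also have "\<dots> = Re (trace (A ** A))"
    by (simp add: trace_def matrix_matrix_mult_def)
  finally show ?thesis
    by (metis norm_ge_zero real_sqrt_unique)
qed

end

theory Submission
  imports Defs
begin

text \<open>
  On a compact set of Hermitian matrices invariant under rotations in coordinate planes, a weighted
  sum of the diagonal entries with distinct weights is maximal only at diagonal matrices sorted by
  the weights. Applied to a unitary orbit this is the spectral theorem with any prescribed order of
  the eigenvalues; applied to a clopen part of an orbit it gives connectedness. On sorted traceless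
  diagonal matrices the potential is a sum of squares plus a quartic form with nonnegative
  coefficients in the eigenvalue gaps, so its zeros can be read off. The sign of
  \<open>Tr (\<Phi>\<^sup>3)\<close> separates the two orbits.
\<close>

text \<open>For nonzero traceless Hermitian \<Phi> of size 5, the ratio of Tr(\<Phi>^4) to
  (Tr(\<Phi>^2))^2 lies between the sharp bounds 7/30 and 13/20. In (A) the quartic trace has a
  positive coefficient and the lower bound matters, in (B) a negative one and the upper bound
  matters. Once the extremal ratio is split off, a quadratic polynomial in Tr(\<Phi>^2) with
  positive leading coefficient remains, and the value of V_0 makes it a perfect square. A zero of V
  therefore has the extremal ratio and a prescribed Tr(\<Phi>^2); the extremal spectra have two
  distinct values, with multiplicities 2 and 3 in (A), 1 and 4 in (B). The potential is even, and
  the minus representative has the negated spectrum of the plus representative. The traces of the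
  second and fourth powers agree on both, so an odd invariant has to tell the orbits apart. The
  diagonals of the representatives are not all listed in monotone order; the freedom in the weights
  adapts the sorted form to each of them, in place of permutation matrices whose determinants would
  need correcting.\<close>

section \<open>Adjoints: algebra and continuity\<close>

lemma adjoint_nth [simp]: "adjoint_matrix A $ i $ j = cnj (A $ j $ i)"
  by (simp add: adjoint_matrix_def transpose_def)

lemma adjoint_mult: "adjoint_matrix (A ** B) = adjoint_matrix B ** adjoint_matrix A"
  by (simp add: vec_eq_iff matrix_matrix_mult_def mult.commute)

lemma adjoint_adjoint [simp]: "adjoint_matrix (adjoint_matrix A) = A"
  by (simp add: vec_eq_iff)

lemma adjoint_mat_1 [simp]: "adjoint_matrix (mat 1) = mat 1"
  by (simp add: vec_eq_iff mat_def)

lemma continuous_on_matrix_mult [continuous_intros]: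
  fixes f :: "'a::topological_space \<Rightarrow> complex^'n^'m"
  assumes "continuous_on S f" "continuous_on S g"
  shows "continuous_on S (\<lambda>x. f x ** g x)"
  unfolding matrix_matrix_mult_def using assms by (intro continuous_intros)

lemma continuous_on_adjoint [continuous_intros]:
  assumes "continuous_on S f"
  shows "continuous_on S (\<lambda>x. adjoint_matrix (f x))"
proof -
  have "continuous_on S (\<lambda>x. \<chi> i j. cnj (f x $ j $ i))"
    using assms by (intro continuous_intros)
  then show ?thesis
    by (simp add: adjoint_matrix_def map_matrix_def transpose_def)
qed

section \<open>The special unitary group and its compactness\<close>

lemma special_unitary_mat_1: "mat 1 \<in> special_unitary"
  by (simp add: special_unitary_def)

lemma special_unitary_mult:
  assumes "U \<in> special_unitary" "W \<in> special_unitary"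
  shows "U ** W \<in> special_unitary"
proof -
  have "adjoint_matrix (U ** W) ** (U ** W) = adjoint_matrix W ** (adjoint_matrix U ** U) ** W"
    by (simp add: adjoint_mult matrix_mul_assoc)
  then show ?thesis
    using assms by (simp add: special_unitary_def det_mul)
qed

lemma special_unitary_adjoint:
  assumes "U \<in> special_unitary"
  shows "adjoint_matrix U \<in> special_unitary" "U ** adjoint_matrix U = mat 1"
proof -
  have U: "adjoint_matrix U ** U = mat 1" "det U = 1"
    using assms by (auto simp: special_unitary_def)
  show *: "U ** adjoint_matrix U = mat 1"
    using U(1) matrix_left_right_inverse by blast
  have "det U * det (adjoint_matrix U) = 1"
    by (metis * det_I det_mul)
  then show "adjoint_matrix U \<in> special_unitary"
    using * U by (simp add: special_unitary_def)
qed

text \<open>Every column of a unitary matrix is a unit vector, which bounds each entry by 1, and the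
  defining equations are continuous in the entries, so they cut out a closed set.\<close>

lemma compact_special_unitary: "compact (special_unitary :: (complex^'n^'n) set)"
proof -
  have "norm U \<le> (\<Sum>i\<in>(UNIV::'n set). \<Sum>j\<in>(UNIV::'n set). 1)" if "U \<in> special_unitary"
    for U :: "complex^'n^'n"
  proof -
    have "cmod (U $ i $ j) \<le> 1" for i j
    proof -
      have "(\<Sum>a\<in>UNIV. cnj (U $ a $ j) * U $ a $ j) = 1"
        using that by (auto simp: special_unitary_def vec_eq_iff matrix_matrix_mult_def mat_def)
      then have "Re (\<Sum>a\<in>UNIV. cnj (U $ a $ j) * U $ a $ j) = 1"
        by simp
      then have "(\<Sum>a\<in>UNIV. (cmod (U $ a $ j))\<^sup>2) = 1"
        by (simp add: cmod_power2 flip: power2_eq_square)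
      moreover have "(cmod (U $ i $ j))\<^sup>2 \<le> (\<Sum>a\<in>UNIV. (cmod (U $ a $ j))\<^sup>2)"
        by (rule member_le_sum) auto
      ultimately show ?thesis
        by (simp add: power_le_one_iff)
    qed
    moreover have "norm U \<le> (\<Sum>i\<in>UNIV. \<Sum>j\<in>UNIV. cmod (U $ i $ j))"
      unfolding norm_vec_def by (meson L2_set_le_sum norm_ge_zero order_trans sum_mono L2_set_nonneg)
    ultimately show ?thesis
      by (meson order_trans sum_mono)
  qed
  then have "bounded (special_unitary :: (complex^'n^'n) set)"
    unfolding bounded_iff by blast
  moreover have "closed (special_unitary :: (complex^'n^'n) set)"
    unfolding special_unitary_def det_def
    by (intro closed_Collect_conj closed_Collect_eq continuous_intros)
  ultimately show ?thesis
    using compact_eq_bounded_closed by blast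
qed

section \<open>Unitary orbits and their trace invariants\<close>

lemma compact_unitary_orbit: "compact (unitary_orbit \<Phi>)"
proof -
  have "unitary_orbit \<Phi> = (\<lambda>U. adjoint_matrix U ** \<Phi> ** U) ` special_unitary"
    by (auto simp: unitary_orbit_def)
  then show ?thesis
    by (auto intro!: compact_continuous_image compact_special_unitary continuous_intros)
qed

lemma unitary_orbit_refl: "\<Phi> \<in> unitary_orbit \<Phi>"
  using special_unitary_mat_1 by (force simp: unitary_orbit_def)

lemma unitary_orbit_trans:
  assumes "B \<in> unitary_orbit A" "C \<in> unitary_orbit B"
  shows "C \<in> unitary_orbit A"
proof -
  obtain U W where *: "U \<in> special_unitary" "W \<in> special_unitary"
    and C: "B = adjoint_matrix U ** A ** U" "C = adjoint_matrix W ** B ** W"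
    using assms by (auto simp: unitary_orbit_def)
  then have "C = adjoint_matrix (U ** W) ** A ** (U ** W)"
    by (simp add: adjoint_mult matrix_mul_assoc)
  then show ?thesis
    using special_unitary_mult[OF *] by (auto simp: unitary_orbit_def)
qed

lemma unitary_orbit_sym:
  assumes "B \<in> unitary_orbit A"
  shows "A \<in> unitary_orbit B"
proof -
  obtain U where U: "U \<in> special_unitary" and B: "B = adjoint_matrix U ** A ** U"
    using assms by (auto simp: unitary_orbit_def)
  have "adjoint_matrix (adjoint_matrix U) ** B ** adjoint_matrix U
      = (U ** adjoint_matrix U) ** A ** (U ** adjoint_matrix U)"
    by (simp add: B matrix_mul_assoc)
  then have "A = adjoint_matrix (adjoint_matrix U) ** B ** adjoint_matrix U"
    by (simp add: special_unitary_adjoint(2)[OF U])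
  then show ?thesis
    using special_unitary_adjoint(1)[OF U] unfolding unitary_orbit_def by blast
qed

lemma trace_conjugate:
  assumes "U \<in> special_unitary"
  shows "trace (adjoint_matrix U ** A ** U) = trace A"
proof -
  have "trace (adjoint_matrix U ** A ** U) = trace (U ** (adjoint_matrix U ** A))"
    by (rule trace_mul_sym)
  also have "\<dots> = trace A"
    by (simp add: matrix_mul_assoc special_unitary_adjoint(2)[OF assms])
  finally show ?thesis .
qed

lemma conjugate_mult:
  assumes "U \<in> special_unitary"
  shows "(adjoint_matrix U ** A ** U) ** (adjoint_matrix U ** B ** U) = adjoint_matrix U ** (A ** B) ** U"
proof -
  have "(adjoint_matrix U ** A ** U) ** (adjoint_matrix U ** B ** U)
      = adjoint_matrix U ** A ** (U ** adjoint_matrix U) ** B ** U"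
    by (simp add: matrix_mul_assoc)
  then show ?thesis
    by (simp add: special_unitary_adjoint(2)[OF assms] matrix_mul_assoc)
qed

lemma trace_powers_unitary_orbit:
  assumes "B \<in> unitary_orbit A"
  shows "trace (B ** B) = trace (A ** A)"
    and "trace (B ** B ** B) = trace (A ** A ** A)"
    and "trace (B ** B ** B ** B) = trace (A ** A ** A ** A)"
  using assms by (auto simp: unitary_orbit_def conjugate_mult trace_conjugate)

lemma potential_unitary_orbit:
  "B \<in> unitary_orbit A \<Longrightarrow> potential mu h lam V0 B = potential mu h lam V0 A"
  by (simp add: potential_def trace_powers_unitary_orbit)

lemma traceless_hermitian_unitary_orbit:
  assumes "A \<in> traceless_hermitian" "B \<in> unitary_orbit A"
  shows "B \<in> traceless_hermitian"
  using assms
  by (auto simp: unitary_orbit_def traceless_hermitian_def trace_conjugate adjoint_mult matrix_mul_assoc)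


section \<open>Rotations in a coordinate plane\<close>

text \<open>For \<open>i \<noteq> j\<close> the block on the coordinates \<open>i\<close>,
  \<open>j\<close> is the element of SU(2) with rows (c, -c cnj z) and (c z, c), where c = 1 / sqrt
  (1 + |z|^2); here z stands for tan(theta) e^(i phi). In place of angles, this makes the parameter
  space the whole complex plane, which is connected, puts the identity at z = 0, and keeps
  everything but c polynomial in \<open>z\<close> and \<open>cnj z\<close>.\<close>

definition rotation :: "'n \<Rightarrow> 'n \<Rightarrow> complex \<Rightarrow> complex^'n^'n" where
  "rotation i j z = (\<chi> a b.
     if b = i then of_real (1 / sqrt (1 + (cmod z)\<^sup>2)) * ((if a = i then 1 else 0) + (if a = j then z else 0))
     else if b = j then of_real (1 / sqrt (1 + (cmod z)\<^sup>2)) * ((if a = j then 1 else 0) + (if a = i then - cnj z else 0))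
     else if a = b then 1 else 0)"

lemma rotation_0: "rotation i j 0 = mat 1"
  by (auto simp: rotation_def mat_def vec_eq_iff)

lemma rotation_scale: "(complex_of_real (1 / sqrt (1 + (cmod z)\<^sup>2)))\<^sup>2 * (1 + z * cnj z) = 1"
proof -
  have "1 + z * cnj z = of_real (1 + (cmod z)\<^sup>2)"
    by (simp only: of_real_add of_real_1 complex_norm_square)
  moreover have "(1 / sqrt (1 + (cmod z)\<^sup>2))\<^sup>2 * (1 + (cmod z)\<^sup>2) = 1"
    using add_pos_nonneg[of 1 "(cmod z)\<^sup>2"] by (simp add: power_divide)
  ultimately show ?thesis
    by (metis of_real_1 of_real_mult of_real_power)
qed

lemma sum_two_deltas:
  fixes f :: "'n::finite \<Rightarrow> 'a::comm_ring_1"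
  assumes "i \<noteq> j"
  shows "(\<Sum>a\<in>UNIV. ((if a = i then x else 0) + (if a = j then y else 0)) * f a) = x * f i + y * f j"
    and "(\<Sum>a\<in>UNIV. f a * ((if a = i then x else 0) + (if a = j then y else 0))) = x * f i + y * f j"
  by (simp_all add: distrib_left distrib_right sum.distrib if_distrib[of "\<lambda>t. t * _"]
      if_distrib[of "\<lambda>t. _ * t"] cong: if_cong)

lemma rotation_mult_nth:
  fixes A :: "complex^'n^'n"
  assumes "i \<noteq> j"
  defines "c z \<equiv> complex_of_real (1 / sqrt (1 + (cmod z)\<^sup>2))"
  shows "(A ** rotation i j z) $ a $ b =
      (if b = i then c z * (A $ a $ i + z * A $ a $ j)
       else if b = j then c z * (A $ a $ j - cnj z * A $ a $ i) else A $ a $ b)"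
    and "(adjoint_matrix (rotation i j z) ** A) $ a $ b =
      (if a = i then c z * (A $ i $ b + cnj z * A $ j $ b)
       else if a = j then c z * (A $ j $ b - z * A $ i $ b) else A $ a $ b)"
proof -
  have scale: "(\<Sum>k\<in>UNIV. f k * (x * g k)) = x * (\<Sum>k\<in>UNIV. f k * g k)"
    "(\<Sum>k\<in>UNIV. (x * g k) * f k) = x * (\<Sum>k\<in>UNIV. g k * f k)"
    for f g :: "'n \<Rightarrow> complex" and x
    by (simp_all add: sum_distrib_left mult.left_commute mult.assoc)
  have delta: "(\<Sum>k\<in>UNIV. f k * (if k = b then 1 else 0)) = f b"
    "(\<Sum>k\<in>UNIV. (if k = b then 1 else 0) * f k) = f b" for f :: "'n \<Rightarrow> complex" and b
    by (simp_all add: if_distrib[of "\<lambda>t. t * _"] if_distrib[of "\<lambda>t. _ * t"] cong: if_cong)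
  have R: "rotation i j z $ k $ b =
      (if b = i then c z * ((if k = i then 1 else 0) + (if k = j then z else 0))
       else if b = j then c z * ((if k = j then 1 else 0) + (if k = i then - cnj z else 0))
       else if k = b then 1 else 0)" for k b
    by (simp add: rotation_def c_def)
  have R': "adjoint_matrix (rotation i j z) $ a $ k =
      (if a = i then c z * ((if k = i then 1 else 0) + (if k = j then cnj z else 0))
       else if a = j then c z * ((if k = j then 1 else 0) + (if k = i then - z else 0))
       else if k = a then 1 else 0)" for k a
    by (simp add: R) (simp add: c_def)
  note sums = scale sum_two_deltas[OF assms(1)] sum_two_deltas[OF assms(1)[symmetric]] delta
  consider "b = i" | "b = j" "b \<noteq> i" | "b \<noteq> i" "b \<noteq> j" by blast
  then show "(A ** rotation i j z) $ a $ b =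
      (if b = i then c z * (A $ a $ i + z * A $ a $ j)
       else if b = j then c z * (A $ a $ j - cnj z * A $ a $ i) else A $ a $ b)"
    by cases (simp_all only: matrix_matrix_mult_def vec_lambda_beta R if_True if_False refl sums, simp_all)
  consider "a = i" | "a = j" "a \<noteq> i" | "a \<noteq> i" "a \<noteq> j" by blast
  then show "(adjoint_matrix (rotation i j z) ** A) $ a $ b =
      (if a = i then c z * (A $ i $ b + cnj z * A $ j $ b)
       else if a = j then c z * (A $ j $ b - z * A $ i $ b) else A $ a $ b)"
    by cases (simp_all only: matrix_matrix_mult_def vec_lambda_beta R' if_True if_False refl sums, simp_all)
qed

lemma rotation_special_unitary:
  fixes i j :: "'n::finite"
  assumes "i \<noteq> j"
  shows "rotation i j z \<in> special_unitary"
proof -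
  define c where "c = complex_of_real (1 / sqrt (1 + (cmod z)\<^sup>2))"
  have c: "c\<^sup>2 * (1 + z * cnj z) = 1"
    unfolding c_def by (rule rotation_scale)
  then have c0: "c \<noteq> 0" by auto
  have cc: "cnj c = c" by (simp add: c_def)
  let ?R = "rotation i j z"
  have R: "?R $ a $ b = (if b = i then if a = i then c else if a = j then c * z else 0
     else if b = j then if a = j then c else if a = i then - c * cnj z else 0
     else if a = b then 1 else 0)" for a b
    using assms by (simp add: rotation_def c_def)
  have "(adjoint_matrix ?R ** ?R) $ a $ b = mat 1 $ a $ b" for a b
    using assms c c0
    by (auto simp: rotation_mult_nth[OF assms, where z = z, folded c_def] R mat_def cc algebra_simps power2_eq_square)
  then have "adjoint_matrix ?R ** ?R = mat 1"
    by (simp add: vec_eq_iff)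
  moreover have "det ?R = 1"
  proof -
    \<comment> \<open>Two row operations diagonalise the block: the first clears the entry (i, j)
      and leaves the pivot c (1 + |z|^2) = 1/c, the second clears the entry (j, i) = c z, hence its
      factor - c^2 z.\<close>
    define A1 where "A1 = (\<chi> k. if k = i then row i ?R + cnj z *s row j ?R else row k ?R)"
    define A2 where "A2 = (\<chi> k. if k = j then row j A1 + (- c\<^sup>2 * z) *s row i A1 else row k A1)"
    have 1: "A1 $ a $ b = (if a = i then if b = i then c * (1 + z * cnj z) else 0 else ?R $ a $ b)" for a b
      using assms by (auto simp: A1_def row_def R algebra_simps)
    have "c\<^sup>2 * z * (c * (1 + z * cnj z)) = c * z"
      using c by (metis (no_types, lifting) mult.assoc mult.commute mult.right_neutral)
    then have 2: "A2 $ a $ b =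
        (if a = b then (if a = i then c * (1 + z * cnj z) else 1) * (if a = j then c else 1) else 0)" for a b
      using assms by (auto simp: A2_def row_def 1 R)
    have "det ?R = det A1"
      unfolding A1_def by (rule det_row_operation[OF assms, symmetric])
    also have "\<dots> = det A2"
      unfolding A2_def using assms by (intro det_row_operation[symmetric]) simp
    also have "\<dots> = (\<Prod>a\<in>UNIV. A2 $ a $ a)"
      by (rule det_diagonal) (simp add: 2)
    also have "\<dots> = c\<^sup>2 * (1 + z * cnj z)"
      by (simp add: 2 prod.distrib power2_eq_square)
    finally show ?thesis
      by (simp add: c)
  qed
  ultimately show ?thesis
    by (simp add: special_unitary_def)
qed

lemma continuous_on_rotation: "continuous_on UNIV (rotation i j)"
proof -
  have "sqrt (1 + (cmod z)\<^sup>2) \<noteq> 0" for z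
    by (smt (verit) real_sqrt_gt_zero zero_le_power2)
  then have "continuous_on UNIV (\<lambda>z. complex_of_real (1 / sqrt (1 + (cmod z)\<^sup>2)))"
    by (intro continuous_intros) auto
  moreover define r where "r z = complex_of_real (1 / sqrt (1 + (cmod z)\<^sup>2))" for z
  ultimately have r: "continuous_on UNIV r"
    by simp
  have entry: "continuous_on UNIV (\<lambda>z. rotation i j z $ a $ b)" for a b
    unfolding rotation_def r_def[symmetric] vec_lambda_beta
    by (cases "b = i"; cases "b = j"; cases "a = i"; cases "a = j"; simp; intro continuous_intros r)
  have "continuous_on UNIV (\<lambda>z. \<chi> a b. rotation i j z $ a $ b)"
    by (rule continuous_on_vec_lambda, rule continuous_on_vec_lambda, rule entry)
  then show ?thesis
    by (simp add: vec_lambda_eta)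
qed

text \<open>The normalising factor enters the two affected diagonal entries squared, so
  multiplication by 1 + |z|^2 removes it and leaves expressions polynomial in \<open>z\<close> and
  \<open>cnj z\<close>. In this form the diagonals before and after a rotation can be compared for
  all \<open>z\<close> at once.\<close>

lemma conjugate_rotation_nth:
  fixes B :: "complex^'n^'n" and z :: complex
  assumes "i \<noteq> j"
  defines "C \<equiv> adjoint_matrix (rotation i j z) ** B ** rotation i j z"
  shows "k \<noteq> i \<Longrightarrow> k \<noteq> j \<Longrightarrow> C $ k $ k = B $ k $ k"
    and "(1 + z * cnj z) * C $ i $ i =
      B $ i $ i + z * cnj z * B $ j $ j + z * B $ i $ j + cnj z * B $ j $ i"
    and "(1 + z * cnj z) * C $ j $ j =
      B $ j $ j + z * cnj z * B $ i $ i - z * B $ i $ j - cnj z * B $ j $ i"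
proof -
  define c where "c = complex_of_real (1 / sqrt (1 + (cmod z)\<^sup>2))"
  have c: "x = y" if "x = c\<^sup>2 * (1 + z * cnj z) * y" for x y
    using that by (simp only: c_def rotation_scale mult_1)
  note nth = rotation_mult_nth[OF assms(1), where z = z, folded c_def]
  show "k \<noteq> i \<Longrightarrow> k \<noteq> j \<Longrightarrow> C $ k $ k = B $ k $ k"
    by (simp add: C_def rotation_mult_nth[OF assms(1)])
  show "(1 + z * cnj z) * C $ i $ i =
      B $ i $ i + z * cnj z * B $ j $ j + z * B $ i $ j + cnj z * B $ j $ i"
    by (rule c) (use assms(1) in \<open>simp add: C_def nth power2_eq_square algebra_simps\<close>)
  show "(1 + z * cnj z) * C $ j $ j =
      B $ j $ j + z * cnj z * B $ i $ i - z * B $ i $ j - cnj z * B $ j $ i"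
    by (rule c) (use assms(1) in \<open>simp add: C_def nth power2_eq_square algebra_simps\<close>)
qed

section \<open>Sorted diagonal representatives and connectedness of orbits\<close>

text \<open>The weights only encode an order of the positions; varying them selects differently
  arranged diagonal matrices from one orbit. Positions of equal weight are left uncompared, so an
  injective \<open>w\<close> is what fixes a total order.\<close>

definition sorted_diagonal :: "('n \<Rightarrow> real) \<Rightarrow> complex^'n^'n \<Rightarrow> bool" where
  "sorted_diagonal w B \<longleftrightarrow>
     (\<exists>d. B = diagonal_matrix (\<chi> i. of_real (d i)) \<and> (\<forall>i j. w j < w i \<longrightarrow> d j \<le> d i))"

text \<open>
  A maximiser of \<open>\<Sum>i. w i * Re (B $ i $ i)\<close> is diagonal and sorted: otherwise one rotation
  in a coordinate plane increases the functional.
\<close>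

lemma exists_sorted_diagonal:
  fixes S :: "(complex^'n^'n) set" and w :: "'n \<Rightarrow> real"
  assumes "compact S" "S \<noteq> {}" "inj w"
    and herm: "\<And>B. B \<in> S \<Longrightarrow> adjoint_matrix B = B"
    and invariant: "\<And>B i j z. B \<in> S \<Longrightarrow> i \<noteq> j \<Longrightarrow>
       adjoint_matrix (rotation i j z) ** B ** rotation i j z \<in> S"
  shows "\<exists>B\<in>S. sorted_diagonal w B"
proof -
  let ?f = "\<lambda>B::complex^'n^'n. \<Sum>k\<in>UNIV. w k * Re (B $ k $ k)"
  have "continuous_on S ?f"
    by (intro continuous_intros)
  then obtain B where B: "B \<in> S" and max: "\<And>C. C \<in> S \<Longrightarrow> ?f C \<le> ?f B"
    using continuous_attains_sup[OF assms(1,2)] by blast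
  define d where "d k = Re (B $ k $ k)" for k
  have adj: "B $ a $ b = cnj (B $ b $ a)" for a b
    using herm[OF B] by (metis adjoint_nth)
  have diag: "B $ k $ k = of_real (d k)" for k
    using adj[of k k] by (simp add: d_def complex_eq_iff)
  \<comment> \<open>This is maximality of \<open>B\<close> against the rotation with parameter
    \<open>z\<close>, multiplied by 1 + |z|^2 and divided by the positive \<open>w i - w j\<close>.
    It holds for every \<open>z\<close>, so the order and the vanishing of the off-diagonal entry
    both follow from suitable choices of \<open>z\<close>.\<close>
  have key: "(cmod z)\<^sup>2 * (d j - d i) + 2 * Re (z * B $ i $ j) \<le> 0" if "w j < w i" for i j z
  proof -
    have ij: "i \<noteq> j" using that by auto
    define C where "C = adjoint_matrix (rotation i j z) ** B ** rotation i j z"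
    define q where "q = (cmod z)\<^sup>2"
    have q: "1 + q > 0"
      by (simp add: q_def add_pos_nonneg)
    have zq: "z * cnj z = of_real q"
      by (simp only: q_def complex_norm_square)
    have "Re ((1 + z * cnj z) * C $ i $ i) = d i + q * d j + 2 * Re (z * B $ i $ j)"
      unfolding C_def conjugate_rotation_nth(2)[OF ij] unfolding zq diag
      by (subst adj[of j i]) (simp add: algebra_simps)
    then have Ci: "(1 + q) * Re (C $ i $ i) = d i + q * d j + 2 * Re (z * B $ i $ j)"
      unfolding zq by (simp add: algebra_simps)
    have "Re ((1 + z * cnj z) * C $ j $ j) = d j + q * d i - 2 * Re (z * B $ i $ j)"
      unfolding C_def conjugate_rotation_nth(3)[OF ij] unfolding zq diag
      by (subst adj[of j i]) (simp add: algebra_simps)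
    then have Cj: "(1 + q) * Re (C $ j $ j) = d j + q * d i - 2 * Re (z * B $ i $ j)"
      unfolding zq by (simp add: algebra_simps)
    have split: "sum g UNIV = g i + g j + sum g (UNIV - {i, j})" for g :: "'n \<Rightarrow> real"
    proof -
      have "sum g UNIV = sum g {i, j} + sum g (UNIV - {i, j})"
        by (subst sum.union_disjoint[symmetric]) (auto simp: Un_Diff_cancel)
      then show ?thesis using ij by simp
    qed
    have "C \<in> S"
      unfolding C_def using B ij by (rule invariant)
    then have "?f C \<le> ?f B"
      by (rule max)
    moreover have "(\<Sum>k\<in>UNIV - {i, j}. w k * Re (C $ k $ k)) = (\<Sum>k\<in>UNIV - {i, j}. w k * Re (B $ k $ k))"
      by (rule sum.cong) (auto simp: C_def conjugate_rotation_nth(1)[OF ij])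
    ultimately have "w i * Re (C $ i $ i) + w j * Re (C $ j $ j) \<le> w i * d i + w j * d j"
      by (simp add: split d_def)
    then have "(1 + q) * (w i * Re (C $ i $ i) + w j * Re (C $ j $ j)) \<le> (1 + q) * (w i * d i + w j * d j)"
      using q by simp
    moreover have "(1 + q) * (w i * Re (C $ i $ i) + w j * Re (C $ j $ j))
        = w i * ((1 + q) * Re (C $ i $ i)) + w j * ((1 + q) * Re (C $ j $ j))"
      by (simp add: algebra_simps)
    ultimately have "(w i - w j) * (q * (d j - d i) + 2 * Re (z * B $ i $ j)) \<le> 0"
      unfolding Ci Cj by (simp add: algebra_simps)
    then show ?thesis
      using that by (simp add: q_def mult_le_0_iff)
  qed
  \<comment> \<open>The terms linear in \<open>z\<close> cancel when the cases z = 1 and z = -1 are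
    added.\<close>
  have sorted: "d j \<le> d i" if "w j < w i" for i j
    using key[OF that, of 1] key[OF that, of "-1"] by simp
  have zero: "B $ i $ j = 0" if "w j < w i" for i j
  proof (rule ccontr)
    assume nz: "B $ i $ j \<noteq> 0"
    \<comment> \<open>The choice z = t * cnj (B $ i $ j) makes the linear term 2 t |B $ i $ j|^2.
      This \<open>t\<close> is small enough that |t (d j - d i)| stays at most 1, so the quadratic
      term cannot outweigh the linear one.\<close>
    define t where "t = 1 / (\<bar>d j - d i\<bar> + 1)"
    have t: "t > 0" "\<bar>t * (d j - d i)\<bar> \<le> 1"
      by (auto simp: t_def abs_mult)
    have "(cmod (of_real t * cnj (B $ i $ j)))\<^sup>2 * (d j - d i)
        + 2 * Re (of_real t * cnj (B $ i $ j) * B $ i $ j) \<le> 0"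
      by (rule key[OF that])
    moreover have "of_real t * cnj (B $ i $ j) * B $ i $ j = complex_of_real (t * (cmod (B $ i $ j))\<^sup>2)"
      by (simp only: of_real_mult complex_norm_square mult_ac)
    ultimately have "t * (cmod (B $ i $ j))\<^sup>2 * (t * (d j - d i) + 2) \<le> 0"
      by (simp only: Re_complex_of_real) (simp add: norm_mult power_mult_distrib power2_eq_square algebra_simps)
    moreover have "t * (cmod (B $ i $ j))\<^sup>2 * (t * (d j - d i) + 2) > 0"
      using t nz by (intro mult_pos_pos) auto
    ultimately show False by simp
  qed
  have "B $ i $ j = 0" if "i \<noteq> j" for i j
  proof (cases "w j < w i")
    case False
    then have "w i < w j"
      using that \<open>inj w\<close> by (metis injD linorder_neqE)
    then show ?thesis
      using zero adj by (metis complex_cnj_zero)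
  qed (rule zero)
  then have "B = diagonal_matrix (\<chi> i. of_real (d i))"
    by (auto simp: diagonal_matrix_def vec_eq_iff diag)
  then show ?thesis
    using B sorted unfolding sorted_diagonal_def by blast
qed

lemma conjugate_rotation_unitary_orbit:
  assumes "B \<in> unitary_orbit A" "i \<noteq> j"
  shows "adjoint_matrix (rotation i j z) ** B ** rotation i j z \<in> unitary_orbit A"
proof (rule unitary_orbit_trans[OF assms(1)])
  show "adjoint_matrix (rotation i j z) ** B ** rotation i j z \<in> unitary_orbit B"
    using rotation_special_unitary[OF assms(2)] by (auto simp: unitary_orbit_def)
qed

lemma sorted_diagonal_in_unitary_orbit:
  fixes A :: "complex^'n^'n"
  assumes "adjoint_matrix A = A" "inj w"
  shows "\<exists>B\<in>unitary_orbit A. sorted_diagonal w B"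
proof (rule exists_sorted_diagonal[OF compact_unitary_orbit _ assms(2)])
  show "adjoint_matrix B = B" if "B \<in> unitary_orbit A" for B
    using that assms(1) by (auto simp: unitary_orbit_def adjoint_mult matrix_mul_assoc)
qed (use unitary_orbit_refl[of A] conjugate_rotation_unitary_orbit in auto)

text \<open>
  Rotations preserve each clopen part of an orbit, so each contains a sorted diagonal matrix.
\<close>

lemma connected_unitary_orbit:
  fixes A :: "complex^'n^'n"
  assumes "adjoint_matrix A = A" "inj w"
    and unique: "\<And>B. B \<in> unitary_orbit A \<Longrightarrow> sorted_diagonal w B \<Longrightarrow> B = D"
  shows "connected (unitary_orbit A)"
proof (rule ccontr)
  assume "\<not> connected (unitary_orbit A)"
  then obtain X Y where X: "closed X" "unitary_orbit A \<inter> X \<noteq> {}"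
    and Y: "closed Y" "unitary_orbit A \<inter> Y \<noteq> {}"
    and XY: "unitary_orbit A \<subseteq> X \<union> Y" "X \<inter> Y \<inter> unitary_orbit A = {}"
    unfolding connected_closed by blast
  \<comment> \<open>Stated for an arbitrary separation, so that it can be applied a second time with
    the two closed sets exchanged.\<close>
  have D: "D \<in> X" if X: "closed X" "unitary_orbit A \<inter> X \<noteq> {}" and Y: "closed Y"
    and XY: "unitary_orbit A \<subseteq> X \<union> Y" "X \<inter> Y \<inter> unitary_orbit A = {}" for X Y
  proof -
    have "\<exists>B\<in>unitary_orbit A \<inter> X. sorted_diagonal w B"
    proof (rule exists_sorted_diagonal[OF _ X(2) \<open>inj w\<close>])
      show "compact (unitary_orbit A \<inter> X)"
        using compact_unitary_orbit X(1) by (rule compact_Int_closed)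
      show "adjoint_matrix B = B" if "B \<in> unitary_orbit A \<inter> X" for B
        using that assms(1) by (auto simp: unitary_orbit_def adjoint_mult matrix_mul_assoc)
      show "adjoint_matrix (rotation i j z) ** B ** rotation i j z \<in> unitary_orbit A \<inter> X"
        if B: "B \<in> unitary_orbit A \<inter> X" and ij: "i \<noteq> j" for B i j z
      proof -
        let ?p = "\<lambda>z. adjoint_matrix (rotation i j z) ** B ** rotation i j z"
        have p: "?p z \<in> unitary_orbit A" for z
          using conjugate_rotation_unitary_orbit[OF _ ij] B by blast
        \<comment> \<open>The rotations with varying \<open>z\<close> sweep out a connected part of
          the orbit that passes through \<open>B\<close> at z = 0. It meets \<open>X\<close>, hence
          cannot reach \<open>Y\<close>.\<close>
        have "connected (range ?p)"
          by (intro connected_continuous_image continuous_intros continuous_on_rotation connected_UNIV)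
        moreover have "?p 0 \<in> X"
          using B by (simp add: rotation_0)
        ultimately have "?p z \<notin> Y"
          using X(1) Y XY p unfolding connected_closed by blast
        then show ?thesis
          using p[of z] XY by blast
      qed
    qed
    then show ?thesis
      using unique by blast
  qed
  have "D \<in> X" "D \<in> Y"
    using D[OF X Y(1) XY] D[OF Y X(1)] XY by (auto simp: Un_commute Int_commute)
  moreover have "D \<in> unitary_orbit A"
    using sorted_diagonal_in_unitary_orbit[OF assms(1,2)] unique by blast
  ultimately show False
    using XY by blast
qed

text \<open>
  For sorted reals with sum zero both quartic forms have nonnegative coefficients when written
  in the gaps between neighbours.
\<close>

lemma quartic_gap_lower:
  fixes a b c d e :: real
  assumes "a \<le> b" "b \<le> c" "c \<le> d" "d \<le> e" and sum: "a + b + c + d + e = 0"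
  shows "8 * ((b - a) ^ 4 + (e - d) ^ 4 + (c - b)\<^sup>2 * (d - c)\<^sup>2)
    \<le> 30 * (a ^ 4 + b ^ 4 + c ^ 4 + d ^ 4 + e ^ 4) - 7 * (a\<^sup>2 + b\<^sup>2 + c\<^sup>2 + d\<^sup>2 + e\<^sup>2)\<^sup>2"
proof -
  define p q r s where pqrs: "p = b - a" "q = c - b" "r = d - c" "s = e - d"
  have nonneg: "p \<ge> 0" "q \<ge> 0" "r \<ge> 0" "s \<ge> 0"
    using assms by (auto simp: pqrs)
  have gaps: "b = a + p" "c = a + p + q" "d = a + p + q + r" "e = a + p + q + r + s"
    "5 * a = - (4 * p + 3 * q + 2 * r + s)"
    using sum by (auto simp: pqrs)
  have "30 * (a ^ 4 + b ^ 4 + c ^ 4 + d ^ 4 + e ^ 4) - 7 * (a\<^sup>2 + b\<^sup>2 + c\<^sup>2 + d\<^sup>2 + e\<^sup>2)\<^sup>2 = 8 * (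
      p ^ 4 + 3 * p ^ 3 * q + 2 * p ^ 3 * r + p ^ 3 * s + 3 * p ^ 2 * q ^ 2 + 4 * p ^ 2 * q * r
       + 2 * p ^ 2 * q * s + p ^ 2 * r ^ 2 + p ^ 2 * r * s + p * q * r ^ 2 + p * q * r * s
       + p * q * s ^ 2 + 2 * p * r * s ^ 2 + p * s ^ 3 + q ^ 2 * r ^ 2 + q ^ 2 * r * s
       + q ^ 2 * s ^ 2 + 4 * q * r * s ^ 2 + 2 * q * s ^ 3 + 3 * r ^ 2 * s ^ 2 + 3 * r * s ^ 3
       + s ^ 4)"
    using gaps by algebra
  \<comment> \<open>The form vanishes when \<open>q\<close> or \<open>r\<close> is the only nonzero
    gap, so it has no monomial q^4 or r^4. The three monomials kept settle equality: they vanish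
    together only if p = s = 0 and one of \<open>q\<close>, \<open>r\<close> is 0, which groups the
    values as 3 + 2 or 2 + 3.\<close>
  moreover have "p ^ 4 + s ^ 4 + q\<^sup>2 * r\<^sup>2 \<le>
      p ^ 4 + 3 * p ^ 3 * q + 2 * p ^ 3 * r + p ^ 3 * s + 3 * p ^ 2 * q ^ 2 + 4 * p ^ 2 * q * r
       + 2 * p ^ 2 * q * s + p ^ 2 * r ^ 2 + p ^ 2 * r * s + p * q * r ^ 2 + p * q * r * s
       + p * q * s ^ 2 + 2 * p * r * s ^ 2 + p * s ^ 3 + q ^ 2 * r ^ 2 + q ^ 2 * r * s
       + q ^ 2 * s ^ 2 + 4 * q * r * s ^ 2 + 2 * q * s ^ 3 + 3 * r ^ 2 * s ^ 2 + 3 * r * s ^ 3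
       + s ^ 4"
    using nonneg by simp
  ultimately show ?thesis
    by (simp add: pqrs)
qed

lemma quartic_gap_upper:
  fixes a b c d e :: real
  assumes "a \<le> b" "b \<le> c" "c \<le> d" "d \<le> e" and sum: "a + b + c + d + e = 0"
  shows "12 * ((c - b) ^ 4 + (d - c) ^ 4 + (b - a)\<^sup>2 * (e - d)\<^sup>2)
    \<le> 13 * (a\<^sup>2 + b\<^sup>2 + c\<^sup>2 + d\<^sup>2 + e\<^sup>2)\<^sup>2 - 20 * (a ^ 4 + b ^ 4 + c ^ 4 + d ^ 4 + e ^ 4)"
proof -
  define p q r s where pqrs: "p = b - a" "q = c - b" "r = d - c" "s = e - d"
  have nonneg: "p \<ge> 0" "q \<ge> 0" "r \<ge> 0" "s \<ge> 0"
    using assms by (auto simp: pqrs)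
  have gaps: "b = a + p" "c = a + p + q" "d = a + p + q + r" "e = a + p + q + r + s"
    "5 * a = - (4 * p + 3 * q + 2 * r + s)"
    using sum by (auto simp: pqrs)
  have "13 * (a\<^sup>2 + b\<^sup>2 + c\<^sup>2 + d\<^sup>2 + e\<^sup>2)\<^sup>2 - 20 * (a ^ 4 + b ^ 4 + c ^ 4 + d ^ 4 + e ^ 4) = 4 * (
      3 * p ^ 2 * q ^ 2 + 4 * p ^ 2 * q * r + 2 * p ^ 2 * q * s + 4 * p ^ 2 * r ^ 2
       + 4 * p ^ 2 * r * s + 3 * p ^ 2 * s ^ 2 + 6 * p * q ^ 3 + 12 * p * q ^ 2 * r
       + 6 * p * q ^ 2 * s + 10 * p * q * r ^ 2 + 10 * p * q * r * s + 4 * p * q * s ^ 2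
       + 4 * p * r ^ 3 + 6 * p * r ^ 2 * s + 2 * p * r * s ^ 2 + 3 * q ^ 4 + 8 * q ^ 3 * r
       + 4 * q ^ 3 * s + 10 * q ^ 2 * r ^ 2 + 10 * q ^ 2 * r * s + 4 * q ^ 2 * s ^ 2
       + 8 * q * r ^ 3 + 12 * q * r ^ 2 * s + 4 * q * r * s ^ 2 + 3 * r ^ 4 + 6 * r ^ 3 * s
       + 3 * r ^ 2 * s ^ 2)"
    using gaps by algebra
  \<comment> \<open>Here the form vanishes when \<open>p\<close> or \<open>s\<close> is the only
    nonzero gap. The monomials kept force q = r = 0 and one of \<open>p\<close>, \<open>s\<close> to
    be 0, which groups the values as 4 + 1 or 1 + 4.\<close>
  moreover have "3 * (q ^ 4 + r ^ 4 + p\<^sup>2 * s\<^sup>2) \<le>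
      3 * p ^ 2 * q ^ 2 + 4 * p ^ 2 * q * r + 2 * p ^ 2 * q * s + 4 * p ^ 2 * r ^ 2
       + 4 * p ^ 2 * r * s + 3 * p ^ 2 * s ^ 2 + 6 * p * q ^ 3 + 12 * p * q ^ 2 * r
       + 6 * p * q ^ 2 * s + 10 * p * q * r ^ 2 + 10 * p * q * r * s + 4 * p * q * s ^ 2
       + 4 * p * r ^ 3 + 6 * p * r ^ 2 * s + 2 * p * r * s ^ 2 + 3 * q ^ 4 + 8 * q ^ 3 * r
       + 4 * q ^ 3 * s + 10 * q ^ 2 * r ^ 2 + 10 * q ^ 2 * r * s + 4 * q ^ 2 * s ^ 2
       + 8 * q * r ^ 3 + 12 * q * r ^ 2 * s + 4 * q * r * s ^ 2 + 3 * r ^ 4 + 6 * r ^ 3 * s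
       + 3 * r ^ 2 * s ^ 2"
    using nonneg by simp
  ultimately show ?thesis
    by (simp add: pqrs)
qed

section \<open>Equality cases of the quartic inequalities\<close>

text \<open>Equality kills the gap terms kept in \<open>quartic_gap_lower\<close>, so only two
  distinct values survive, with multiplicities 3 and 2. The zero sum fixes their ratio as -2 : 3,
  \<open>T2\<close> fixes the scale, and the sorting fixes the sign.\<close>

lemma quartic_gap_lower_eq:
  fixes a b c d e u :: real
  assumes sorted: "a \<le> b" "b \<le> c" "c \<le> d" "d \<le> e" and sum: "a + b + c + d + e = 0"
    and T2: "a\<^sup>2 + b\<^sup>2 + c\<^sup>2 + d\<^sup>2 + e\<^sup>2 = 30 * u\<^sup>2" and "u > 0"
    and eq: "30 * (a ^ 4 + b ^ 4 + c ^ 4 + d ^ 4 + e ^ 4) = 7 * (a\<^sup>2 + b\<^sup>2 + c\<^sup>2 + d\<^sup>2 + e\<^sup>2)\<^sup>2"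
  shows "a = - 2 * u \<and> b = - 2 * u \<and> c = - 2 * u \<and> d = 3 * u \<and> e = 3 * u \<or>
    a = - 3 * u \<and> b = - 3 * u \<and> c = 2 * u \<and> d = 2 * u \<and> e = 2 * u"
proof -
  have le: "(b - a) ^ 4 + (e - d) ^ 4 + (c - b)\<^sup>2 * (d - c)\<^sup>2 \<le> 0"
    using quartic_gap_lower[OF sorted sum] eq by simp
  have ge: "(b - a) ^ 4 \<ge> 0" "(e - d) ^ 4 \<ge> 0" "(c - b)\<^sup>2 * (d - c)\<^sup>2 \<ge> 0"
    by simp_all
  have "(b - a) ^ 4 = 0" "(e - d) ^ 4 = 0" "(c - b)\<^sup>2 * (d - c)\<^sup>2 = 0"
    using le ge by linarith+
  then have ba: "b = a" and de: "e = d" and "c = b \<or> d = c"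
    by auto
  then consider "c = a" | "c = d" by auto
  then show ?thesis
  proof cases
    case 1
    have 2: "2 * d = - 3 * a"
      using sum 1 ba de by linarith
    have "4 * (3 * a\<^sup>2 + 2 * d\<^sup>2) = 120 * u\<^sup>2"
      using T2 1 ba de by simp
    moreover have "4 * (3 * a\<^sup>2 + 2 * d\<^sup>2) = 30 * a\<^sup>2"
      using 2 by algebra
    ultimately have "a\<^sup>2 = (2 * u)\<^sup>2"
      by (simp add: power_mult_distrib)
    \<comment> \<open>The other root a = 2 u would give d = - 3 u, below \<open>a\<close>.\<close>
    then have "a = - 2 * u"
      using 2 sorted 1 \<open>u > 0\<close> unfolding power2_eq_iff by auto
    then show ?thesis
      using 2 1 ba de by simp
  next
    case 2
    have 3: "2 * a = - 3 * d"
      using sum 2 ba de by linarith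
    have "4 * (2 * a\<^sup>2 + 3 * d\<^sup>2) = 120 * u\<^sup>2"
      using T2 2 ba de by simp
    moreover have "4 * (2 * a\<^sup>2 + 3 * d\<^sup>2) = 30 * d\<^sup>2"
      using 3 by algebra
    ultimately have "d\<^sup>2 = (2 * u)\<^sup>2"
      by (simp add: power_mult_distrib)
    then have "d = 2 * u"
      using 3 sorted 2 ba de \<open>u > 0\<close> unfolding power2_eq_iff by auto
    then show ?thesis
      using 3 2 ba de by simp
  qed
qed

text \<open>As in the lower case, but the surviving gap terms isolate a single smallest or largest
  value, and the zero sum makes it -4 times the value shared by the other four.\<close>

lemma quartic_gap_upper_eq:
  fixes a b c d e v :: real
  assumes sorted: "a \<le> b" "b \<le> c" "c \<le> d" "d \<le> e" and sum: "a + b + c + d + e = 0"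
    and T2: "a\<^sup>2 + b\<^sup>2 + c\<^sup>2 + d\<^sup>2 + e\<^sup>2 = 20 * v\<^sup>2" and "v > 0"
    and eq: "20 * (a ^ 4 + b ^ 4 + c ^ 4 + d ^ 4 + e ^ 4) = 13 * (a\<^sup>2 + b\<^sup>2 + c\<^sup>2 + d\<^sup>2 + e\<^sup>2)\<^sup>2"
  shows "a = - 4 * v \<and> b = v \<and> c = v \<and> d = v \<and> e = v \<or>
    a = - v \<and> b = - v \<and> c = - v \<and> d = - v \<and> e = 4 * v"
proof -
  have le: "(c - b) ^ 4 + (d - c) ^ 4 + (b - a)\<^sup>2 * (e - d)\<^sup>2 \<le> 0"
    using quartic_gap_upper[OF sorted sum] eq by simp
  have ge: "(c - b) ^ 4 \<ge> 0" "(d - c) ^ 4 \<ge> 0" "(b - a)\<^sup>2 * (e - d)\<^sup>2 \<ge> 0"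
    by simp_all
  have "(c - b) ^ 4 = 0" "(d - c) ^ 4 = 0" "(b - a)\<^sup>2 * (e - d)\<^sup>2 = 0"
    using le ge by linarith+
  then have cb: "c = b" and dc: "d = c" and "b = a \<or> e = d"
    by auto
  then consider "c = a" | "e = c" by auto
  then show ?thesis
  proof cases
    case 1
    have 2: "e = - 4 * a"
      using sum 1 cb dc by linarith
    then have "a\<^sup>2 = v\<^sup>2"
      using T2 1 cb dc by (simp add: power_mult_distrib)
    then have "a = - v"
      using 2 sorted 1 \<open>v > 0\<close> unfolding power2_eq_iff by auto
    then show ?thesis
      using 2 1 cb dc by simp
  next
    case 2
    have 3: "a = - 4 * c"
      using sum 2 cb dc by linarith
    then have "c\<^sup>2 = v\<^sup>2"
      using T2 2 cb dc by (simp add: power_mult_distrib)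
    then have "c = v"
      using 3 sorted 2 cb dc \<open>v > 0\<close> unfolding power2_eq_iff by auto
    then show ?thesis
      using 3 2 cb dc by simp
  qed
qed

section \<open>From sorted representatives to the zero set\<close>

text \<open>Common skeleton of (A) and (B). Since \<open>V\<close> and \<open>K\<close> are constant
  on orbits, claims about all matrices reduce to sorted diagonal ones. The sign of \<open>K\<close>
  decides whether a zero of \<open>V\<close> is conjugate to \<open>D1\<close> or to
  \<open>D2\<close>, and the same uniqueness of the sorted representative feeds
  \<open>connected_unitary_orbit\<close>. Separate weights let \<open>D1\<close> and
  \<open>D2\<close> be arranged independently.\<close>

lemma two_orbit_vacuum:
  fixes V K :: "complex^'n^'n \<Rightarrow> real"
  assumes V: "\<And>A B. B \<in> unitary_orbit A \<Longrightarrow> V B = V A"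
    and K: "\<And>A B. B \<in> unitary_orbit A \<Longrightarrow> K B = K A"
    and w: "inj w1" "inj w2"
    and nonneg: "\<And>B. B \<in> traceless_hermitian \<Longrightarrow> sorted_diagonal w1 B \<Longrightarrow> V B \<ge> 0"
    and K_nz: "\<And>B. B \<in> traceless_hermitian \<Longrightarrow> sorted_diagonal w1 B \<Longrightarrow> V B = 0 \<Longrightarrow> K B \<noteq> 0"
    and D1: "\<And>B. B \<in> traceless_hermitian \<Longrightarrow> sorted_diagonal w1 B \<Longrightarrow> V B = 0 \<Longrightarrow> K B > 0 \<Longrightarrow> B = D1"
    and D2: "\<And>B. B \<in> traceless_hermitian \<Longrightarrow> sorted_diagonal w2 B \<Longrightarrow> V B = 0 \<Longrightarrow> K B < 0 \<Longrightarrow> B = D2"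
    and D: "D1 \<in> traceless_hermitian" "V D1 = 0" "K D1 > 0" "D2 \<in> traceless_hermitian" "V D2 = 0" "K D2 < 0"
  shows "(\<forall>\<Phi> \<in> traceless_hermitian. V \<Phi> \<ge> 0) \<and>
    {\<Phi> \<in> traceless_hermitian. V \<Phi> = 0} = unitary_orbit D2 \<union> unitary_orbit D1 \<and>
    compact (unitary_orbit D2) \<and> compact (unitary_orbit D1) \<and>
    connected (unitary_orbit D2) \<and> connected (unitary_orbit D1) \<and>
    unitary_orbit D2 \<inter> unitary_orbit D1 = {}"
proof (intro conjI)
  have herm: "adjoint_matrix \<Phi> = \<Phi>" if "\<Phi> \<in> traceless_hermitian" for \<Phi> :: "complex^'n^'n"
    using that by (simp add: traceless_hermitian_def)
  note TH = traceless_hermitian_unitary_orbit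
  show "\<forall>\<Phi> \<in> traceless_hermitian. V \<Phi> \<ge> 0"
    using sorted_diagonal_in_unitary_orbit[OF herm w(1)] TH nonneg V by metis
  have K0: "K \<Phi> \<noteq> 0" if "\<Phi> \<in> traceless_hermitian" "V \<Phi> = 0" for \<Phi>
    using sorted_diagonal_in_unitary_orbit[OF herm w(1)] TH K_nz V K that by metis
  show "{\<Phi> \<in> traceless_hermitian. V \<Phi> = 0} = unitary_orbit D2 \<union> unitary_orbit D1"
  proof (intro equalityI subsetI)
    fix \<Phi> assume "\<Phi> \<in> {\<Phi> \<in> traceless_hermitian. V \<Phi> = 0}"
    then have \<Phi>: "\<Phi> \<in> traceless_hermitian" "V \<Phi> = 0" by auto
    then consider "K \<Phi> > 0" | "K \<Phi> < 0"
      using K0 by force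
    then have "D1 \<in> unitary_orbit \<Phi> \<or> D2 \<in> unitary_orbit \<Phi>"
    proof cases
      case 1
      obtain B where B: "B \<in> unitary_orbit \<Phi>" "sorted_diagonal w1 B"
        using sorted_diagonal_in_unitary_orbit[OF herm[OF \<Phi>(1)] w(1)] by blast
      then have "B = D1"
        using 1 \<Phi> by (intro D1) (auto simp: V[OF B(1)] K[OF B(1)] intro: TH)
      then show ?thesis using B by simp
    next
      case 2
      obtain B where B: "B \<in> unitary_orbit \<Phi>" "sorted_diagonal w2 B"
        using sorted_diagonal_in_unitary_orbit[OF herm[OF \<Phi>(1)] w(2)] by blast
      then have "B = D2"
        using 2 \<Phi> by (intro D2) (auto simp: V[OF B(1)] K[OF B(1)] intro: TH)
      then show ?thesis using B by simp
    qed
    then show "\<Phi> \<in> unitary_orbit D2 \<union> unitary_orbit D1"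
      using unitary_orbit_sym by blast
  next
    fix \<Phi> assume "\<Phi> \<in> unitary_orbit D2 \<union> unitary_orbit D1"
    then show "\<Phi> \<in> {\<Phi> \<in> traceless_hermitian. V \<Phi> = 0}"
      using D V TH by auto
  qed
  show "compact (unitary_orbit D2)" "compact (unitary_orbit D1)"
    by (rule compact_unitary_orbit)+
  show "connected (unitary_orbit D2)"
  proof (rule connected_unitary_orbit[OF herm[OF D(4)] w(2)])
    show "B = D2" if "B \<in> unitary_orbit D2" "sorted_diagonal w2 B" for B
      using that D by (intro D2) (auto simp: V[OF that(1)] K[OF that(1)] intro: TH)
  qed
  show "connected (unitary_orbit D1)"
  proof (rule connected_unitary_orbit[OF herm[OF D(1)] w(1)])
    show "B = D1" if "B \<in> unitary_orbit D1" "sorted_diagonal w1 B" for B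
      using that D by (intro D1) (auto simp: V[OF that(1)] K[OF that(1)] intro: TH)
  qed
  show "unitary_orbit D2 \<inter> unitary_orbit D1 = {}"
    using K D by (metis disjoint_iff less_asym)
qed

section \<open>Diagonal matrices of size 5\<close>

lemma diagonal_matrix_mult:
  fixes x y :: "complex^'n"
  shows "diagonal_matrix x ** diagonal_matrix y = diagonal_matrix (\<chi> i. x $ i * y $ i)"
  by (simp add: diagonal_matrix_def matrix_matrix_mult_def vec_eq_iff if_distrib[of "\<lambda>t. t * _"]
      if_distrib[of "\<lambda>t. _ * t"] cong: if_cong)

lemma trace_diagonal_matrix: "trace (diagonal_matrix x) = (\<Sum>i\<in>UNIV. x $ i)"
  by (simp add: trace_def diagonal_matrix_def)

lemma exhaust_5:
  fixes x :: 5
  shows "x = 1 \<or> x = 2 \<or> x = 3 \<or> x = 4 \<or> x = 5"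
proof (induct x)
  case (of_int z)
  then have "z = 0 \<or> z = 1 \<or> z = 2 \<or> z = 3 \<or> z = 4" by fastforce
  then show ?case by auto
qed

lemma forall_5: "(\<forall>i::5. P i) \<longleftrightarrow> P 1 \<and> P 2 \<and> P 3 \<and> P 4 \<and> P 5"
  by (metis exhaust_5)

lemma UNIV_5: "UNIV = {1, 2, 3, 4, 5::5}"
  using exhaust_5 by auto

lemma sum_5: "sum f (UNIV::5 set) = f 1 + f 2 + f 3 + f 4 + f 5"
  unfolding UNIV_5 by (simp add: ac_simps)

abbreviation real_diagonal :: "(5 \<Rightarrow> real) \<Rightarrow> complex^5^5" where
  "real_diagonal d \<equiv> diagonal_matrix (\<chi> i. of_real (d i))"

lemma real_diagonal_traceless_hermitian:
  "real_diagonal d \<in> traceless_hermitian \<longleftrightarrow> d 1 + d 2 + d 3 + d 4 + d 5 = 0"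
proof -
  have "adjoint_matrix (real_diagonal d) = real_diagonal d"
    by (simp add: vec_eq_iff diagonal_matrix_def)
  moreover have "trace (real_diagonal d) = of_real (d 1 + d 2 + d 3 + d 4 + d 5)"
    by (simp add: trace_diagonal_matrix sum_5)
  ultimately show ?thesis
    by (simp only: traceless_hermitian_def mem_Collect_eq of_real_eq_0_iff simp_thms)
qed

lemma real_diagonal_traces:
  defines "B d \<equiv> real_diagonal d"
  shows "Re (trace (B d ** B d)) = (d 1)\<^sup>2 + (d 2)\<^sup>2 + (d 3)\<^sup>2 + (d 4)\<^sup>2 + (d 5)\<^sup>2"
    and "Re (trace (B d ** B d ** B d)) = d 1 ^ 3 + d 2 ^ 3 + d 3 ^ 3 + d 4 ^ 3 + d 5 ^ 3"
    and "Re (trace (B d ** B d ** B d ** B d)) = d 1 ^ 4 + d 2 ^ 4 + d 3 ^ 4 + d 4 ^ 4 + d 5 ^ 4"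
  by (simp_all add: B_def diagonal_matrix_mult trace_diagonal_matrix sum_5 power2_eq_square
      power3_eq_cube power4_eq_xxxx)

lemma inj_vector_5: "inj (($) (vector [a, b, c, d, e] :: real^5)) \<longleftrightarrow> distinct [a, b, c, d, e]"
  unfolding inj_def forall_5 by auto

text \<open>Five distinct indices exhaust the type. This lets power sums of the diagonal be
  rewritten in whichever order sorts its entries, as the quartic inequalities demand.\<close>

lemma sum_distinct_5:
  fixes g :: "5 \<Rightarrow> real"
  assumes "distinct [i1, i2, i3, i4, i5]"
  shows "sum g UNIV = g i1 + g i2 + g i3 + g i4 + g i5"
proof -
  have "{i1, i2, i3, i4, i5} = UNIV"
    using assms by (intro card_subset_eq) auto
  then have "sum g UNIV = sum g {i1, i2, i3, i4, i5}" by simp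
  then show ?thesis using assms by (simp add: add.assoc)
qed

lemma real_diagonal_cong:
  assumes "f 1 = g 1" "f 2 = g 2" "f 3 = g 3" "f 4 = g 4" "f 5 = g 5"
  shows "real_diagonal f = real_diagonal g"
  using assms unfolding vec_eq_iff forall_5 by (simp add: diagonal_matrix_def)

section \<open>The potential with the square completed\<close>

text \<open>Splitting 7/30 of t^2 off \<open>q\<close> in case (A) leaves t^2 with coefficient lam
  (7/30 - 3/20) = lam/12, and 30 u^2 is the value of \<open>t\<close> at the vacuum. Both summands
  are nonnegative, so at a zero both vanish and the equality case applies.\<close>

lemma quartic_vacuum_lower:
  fixes a b c d e u lam t q :: real
  assumes sorted: "a \<le> b" "b \<le> c" "c \<le> d" "d \<le> e" and sum: "a + b + c + d + e = 0"
    and t: "t = a\<^sup>2 + b\<^sup>2 + c\<^sup>2 + d\<^sup>2 + e\<^sup>2" and q: "q = a ^ 4 + b ^ 4 + c ^ 4 + d ^ 4 + e ^ 4"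
    and "lam > 0" "u > 0"
  defines "V \<equiv> lam / 30 * (30 * q - 7 * t\<^sup>2) + lam / 12 * (t - 30 * u\<^sup>2)\<^sup>2"
  shows "V \<ge> 0"
    and "V = 0 \<Longrightarrow> a = - 2 * u \<and> b = - 2 * u \<and> c = - 2 * u \<and> d = 3 * u \<and> e = 3 * u \<or>
      a = - 3 * u \<and> b = - 3 * u \<and> c = 2 * u \<and> d = 2 * u \<and> e = 2 * u"
proof -
  have "0 \<le> 8 * ((b - a) ^ 4 + (e - d) ^ 4 + (c - b)\<^sup>2 * (d - c)\<^sup>2)"
    by simp
  then have "30 * q - 7 * t\<^sup>2 \<ge> 0"
    using quartic_gap_lower[OF sorted sum] unfolding t q by linarith
  then have *: "lam / 30 * (30 * q - 7 * t\<^sup>2) \<ge> 0" "lam / 12 * (t - 30 * u\<^sup>2)\<^sup>2 \<ge> 0"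
    using \<open>lam > 0\<close> by simp_all
  then show "V \<ge> 0"
    unfolding V_def by linarith
  assume "V = 0"
  then have "lam / 30 * (30 * q - 7 * t\<^sup>2) = 0" "lam / 12 * (t - 30 * u\<^sup>2)\<^sup>2 = 0"
    using * unfolding V_def by linarith+
  then have "30 * q = 7 * t\<^sup>2" "t = 30 * u\<^sup>2"
    using \<open>lam > 0\<close> by auto
  then show "a = - 2 * u \<and> b = - 2 * u \<and> c = - 2 * u \<and> d = 3 * u \<and> e = 3 * u \<or>
      a = - 3 * u \<and> b = - 3 * u \<and> c = 2 * u \<and> d = 2 * u \<and> e = 2 * u"
    using quartic_gap_lower_eq[OF sorted sum _ \<open>u > 0\<close>] unfolding t q by blast
qed

text \<open>In case (B) \<open>q\<close> has the negative coefficient -10 h / 9, so the upper bound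
  13/20 is split off; t^2 keeps the coefficient h (1 - 13/18) = 5 h / 18, and 20 v^2 is the value of
  \<open>t\<close> at the vacuum.\<close>

lemma quartic_vacuum_upper:
  fixes a b c d e v h t q :: real
  assumes sorted: "a \<le> b" "b \<le> c" "c \<le> d" "d \<le> e" and sum: "a + b + c + d + e = 0"
    and t: "t = a\<^sup>2 + b\<^sup>2 + c\<^sup>2 + d\<^sup>2 + e\<^sup>2" and q: "q = a ^ 4 + b ^ 4 + c ^ 4 + d ^ 4 + e ^ 4"
    and "h > 0" "v > 0"
  defines "V \<equiv> h / 18 * (13 * t\<^sup>2 - 20 * q) + 5 * h / 18 * (t - 20 * v\<^sup>2)\<^sup>2"
  shows "V \<ge> 0"
    and "V = 0 \<Longrightarrow> a = - 4 * v \<and> b = v \<and> c = v \<and> d = v \<and> e = v \<or>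
      a = - v \<and> b = - v \<and> c = - v \<and> d = - v \<and> e = 4 * v"
proof -
  have "0 \<le> 12 * ((c - b) ^ 4 + (d - c) ^ 4 + (b - a)\<^sup>2 * (e - d)\<^sup>2)"
    by simp
  then have "13 * t\<^sup>2 - 20 * q \<ge> 0"
    using quartic_gap_upper[OF sorted sum] unfolding t q by linarith
  then have *: "h / 18 * (13 * t\<^sup>2 - 20 * q) \<ge> 0" "5 * h / 18 * (t - 20 * v\<^sup>2)\<^sup>2 \<ge> 0"
    using \<open>h > 0\<close> by simp_all
  then show "V \<ge> 0"
    unfolding V_def by linarith
  assume "V = 0"
  then have "h / 18 * (13 * t\<^sup>2 - 20 * q) = 0" "5 * h / 18 * (t - 20 * v\<^sup>2)\<^sup>2 = 0"
    using * unfolding V_def by linarith+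
  then have "20 * q = 13 * t\<^sup>2" "t = 20 * v\<^sup>2"
    using \<open>h > 0\<close> by auto
  then show "a = - 4 * v \<and> b = v \<and> c = v \<and> d = v \<and> e = v \<or>
      a = - v \<and> b = - v \<and> c = - v \<and> d = - v \<and> e = 4 * v"
    using quartic_gap_upper_eq[OF sorted sum _ \<open>v > 0\<close>] unfolding t q by blast
qed

lemma real_diagonal_eq_vector:
  "real_diagonal f = u *\<^sub>R diagonal_matrix (vector [a, b, c, d, e])"
  if "of_real (f 1) = u *\<^sub>R a" "of_real (f 2) = u *\<^sub>R b" "of_real (f 3) = u *\<^sub>R c"
    "of_real (f 4) = u *\<^sub>R d" "of_real (f 5) = u *\<^sub>R e"
  using that unfolding vec_eq_iff forall_5 by (simp add: diagonal_matrix_def)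

section \<open>The two parameter cases\<close>

lemma vacuum_A:
  fixes mu lam :: real
  assumes "mu > 0" "lam > 0"
  defines "V \<equiv> potential mu (- (3 / 20) * lam) lam (3 * mu ^ 4 / lam)"
  shows "(\<forall>\<Phi> \<in> traceless_hermitian. V \<Phi> \<ge> 0) \<and>
    {\<Phi> \<in> traceless_hermitian. V \<Phi> = 0} = unitary_orbit (PhiA_minus mu lam) \<union> unitary_orbit (PhiA_plus mu lam) \<and>
    compact (unitary_orbit (PhiA_minus mu lam)) \<and> compact (unitary_orbit (PhiA_plus mu lam)) \<and>
    connected (unitary_orbit (PhiA_minus mu lam)) \<and> connected (unitary_orbit (PhiA_plus mu lam)) \<and>
    unitary_orbit (PhiA_minus mu lam) \<inter> unitary_orbit (PhiA_plus mu lam) = {}"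
proof -
  \<comment> \<open>The weights are chosen so that the given diagonals are sorted: 3 sits at the two
    heaviest positions for \<open>?plus\<close>, and -3 at positions 3 and 4, the two lightest for
    \<open>?minus\<close>.\<close>
  let ?plus = "($) (vector [5, 4, 3, 2, 1] :: real^5)"
  let ?minus = "($) (vector [5, 4, 2, 1, 3] :: real^5)"
  define u where "u = sqrt 5 * mu / (5 * sqrt lam)"
  have u: "u > 0"
    using assms by (simp add: u_def)
  have u2: "u\<^sup>2 = mu\<^sup>2 / (5 * lam)"
    using assms by (simp add: u_def power_divide power_mult_distrib)
  \<comment> \<open>The cubic trace equals 30 u^3 at the plus representative and -30 u^3 at the
    minus one.\<close>
  define K where "K \<Phi> = Re (trace (\<Phi> ** \<Phi> ** \<Phi>))" for \<Phi> :: "complex^5^5"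
  \<comment> \<open>In terms of \<open>u\<close> one has mu^2 = 5 lam u^2 and the constant term is
    75 lam u^4, which is what the square centred at 30 u^2 requires.\<close>
  have VE: "V \<Phi> = lam / 30 * (30 * Re (trace (\<Phi> ** \<Phi> ** \<Phi> ** \<Phi>)) - 7 * (Re (trace (\<Phi> ** \<Phi>)))\<^sup>2)
      + lam / 12 * (Re (trace (\<Phi> ** \<Phi>)) - 30 * u\<^sup>2)\<^sup>2" for \<Phi>
    unfolding V_def potential_def u2 using \<open>lam > 0\<close> by (simp add: field_simps power2_eq_square power4_eq_xxxx)
  define dp where "dp = ($) (vector [3 * u, 3 * u, - 2 * u, - 2 * u, - 2 * u] :: real^5)"
  define dm where "dm = ($) (vector [2 * u, 2 * u, - 3 * u, - 3 * u, 2 * u] :: real^5)"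
  have plus: "PhiA_plus mu lam = real_diagonal dp" and minus: "PhiA_minus mu lam = real_diagonal dm"
    unfolding PhiA_plus_def PhiA_minus_def u_def[symmetric] dp_def dm_def
    by (rule real_diagonal_eq_vector[symmetric]; simp add: scaleR_conv_of_real)+
  \<comment> \<open>The indices are left arbitrary so that one statement serves the orders of both
    weights.\<close>
  have cases: "V B \<ge> 0"
      "V B = 0 \<Longrightarrow> f i1 = - 2 * u \<and> f i2 = - 2 * u \<and> f i3 = - 2 * u \<and> f i4 = 3 * u \<and> f i5 = 3 * u \<or>
        f i1 = - 3 * u \<and> f i2 = - 3 * u \<and> f i3 = 2 * u \<and> f i4 = 2 * u \<and> f i5 = 2 * u"
    if "B = real_diagonal f" "B \<in> traceless_hermitian"
      "f i1 \<le> f i2" "f i2 \<le> f i3" "f i3 \<le> f i4" "f i4 \<le> f i5" "distinct [i1, i2, i3, i4, i5]"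
    for B f i1 i2 i3 i4 i5
  proof -
    note univ5 = sum_distinct_5[OF that(7), unfolded sum_5]
    have sum: "f i1 + f i2 + f i3 + f i4 + f i5 = 0"
      using that(2) univ5[of f] by (simp add: that(1) real_diagonal_traceless_hermitian)
    note * = quartic_vacuum_lower[OF that(3-6) sum refl refl \<open>lam > 0\<close> u]
    show "V B \<ge> 0"
      using *(1) unfolding VE that(1) real_diagonal_traces univ5[of "\<lambda>i. (f i)\<^sup>2"] univ5[of "\<lambda>i. f i ^ 4"] .
    show "V B = 0 \<Longrightarrow> f i1 = - 2 * u \<and> f i2 = - 2 * u \<and> f i3 = - 2 * u \<and> f i4 = 3 * u \<and> f i5 = 3 * u \<or>
        f i1 = - 3 * u \<and> f i2 = - 3 * u \<and> f i3 = 2 * u \<and> f i4 = 2 * u \<and> f i5 = 2 * u"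
      using *(2) unfolding VE that(1) real_diagonal_traces univ5[of "\<lambda>i. (f i)\<^sup>2"] univ5[of "\<lambda>i. f i ^ 4"] .
  qed
  have K: "K (real_diagonal f) = (f 1 ^ 3 + f 2 ^ 3 + f 3 ^ 3 + f 4 ^ 3 + f 5 ^ 3)" for f
    by (simp add: K_def real_diagonal_traces)
  have sorted1: thesis
    if "sorted_diagonal ?plus B"
      "\<And>f. B = real_diagonal f \<Longrightarrow> f 5 \<le> f 4 \<Longrightarrow> f 4 \<le> f 3 \<Longrightarrow> f 3 \<le> f 2 \<Longrightarrow> f 2 \<le> f 1 \<Longrightarrow> thesis"
    for B thesis
    using that unfolding sorted_diagonal_def by fastforce
  have sorted2: thesis
    if "sorted_diagonal ?minus B"
      "\<And>f. B = real_diagonal f \<Longrightarrow> f 4 \<le> f 3 \<Longrightarrow> f 3 \<le> f 5 \<Longrightarrow> f 5 \<le> f 2 \<Longrightarrow> f 2 \<le> f 1 \<Longrightarrow> thesis"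
    for B thesis
    using that unfolding sorted_diagonal_def by fastforce
  have u3: "u ^ 3 > 0"
    using u by simp
  show ?thesis
  proof (rule two_orbit_vacuum[where K = K and ?w1.0 = "?plus"
      and ?w2.0 = "?minus"])
    show "V B = V A" if "B \<in> unitary_orbit A" for A B
      unfolding V_def using that by (rule potential_unitary_orbit)
    show "K B = K A" if "B \<in> unitary_orbit A" for A B
      unfolding K_def using trace_powers_unitary_orbit(2)[OF that] by simp
    show "inj ?plus" "inj ?minus"
      unfolding inj_vector_5 by simp_all
    fix B :: "complex^5^5"
    assume B: "B \<in> traceless_hermitian"
    show "V B \<ge> 0" if s: "sorted_diagonal ?plus B"
      using s
    proof (rule sorted1)
      fix f assume f: "B = real_diagonal f" "f 5 \<le> f 4" "f 4 \<le> f 3" "f 3 \<le> f 2" "f 2 \<le> f 1"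
      show ?thesis
        using cases(1)[OF f(1) B f(2-5)] by simp
    qed
    show "K B \<noteq> 0" if s: "sorted_diagonal ?plus B" and "V B = 0"
      using s
    proof (rule sorted1)
      fix f assume f: "B = real_diagonal f" "f 5 \<le> f 4" "f 4 \<le> f 3" "f 3 \<le> f 2" "f 2 \<le> f 1"
      show ?thesis
        using cases(2)[OF f(1) B f(2-5) _ \<open>V B = 0\<close>] u3 by (auto simp: f(1) K power_mult_distrib)
    qed
    show "B = PhiA_plus mu lam" if s: "sorted_diagonal ?plus B" and "V B = 0" "K B > 0"
      using s
    proof (rule sorted1)
      fix f assume f: "B = real_diagonal f" "f 5 \<le> f 4" "f 4 \<le> f 3" "f 3 \<le> f 2" "f 2 \<le> f 1"
      show ?thesis
        \<comment> \<open>The sign of \<open>K\<close> rules out one of the two spectra, and the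
          order of the weights then determines every entry.\<close>
        unfolding plus f(1) using cases(2)[OF f(1) B f(2-5) _ \<open>V B = 0\<close>] u3 \<open>K B > 0\<close>
        by (intro real_diagonal_cong) (auto simp: f(1) K dp_def power_mult_distrib)
    qed
    show "B = PhiA_minus mu lam" if s: "sorted_diagonal ?minus B" and "V B = 0" "K B < 0"
      using s
    proof (rule sorted2)
      fix f assume f: "B = real_diagonal f" "f 4 \<le> f 3" "f 3 \<le> f 5" "f 5 \<le> f 2" "f 2 \<le> f 1"
      show ?thesis
        unfolding minus f(1) using cases(2)[OF f(1) B f(2-5) _ \<open>V B = 0\<close>] u3 \<open>K B < 0\<close>
        by (intro real_diagonal_cong) (auto simp: f(1) K dm_def power_mult_distrib)
    qed
  next
    show "PhiA_plus mu lam \<in> traceless_hermitian" "PhiA_minus mu lam \<in> traceless_hermitian"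
      unfolding plus minus real_diagonal_traceless_hermitian by (simp_all add: dp_def dm_def)
    show "V (PhiA_plus mu lam) = 0" "V (PhiA_minus mu lam) = 0"
      unfolding plus minus VE real_diagonal_traces by (simp_all add: dp_def dm_def power_mult_distrib flip: power_mult)
    show "K (PhiA_plus mu lam) > 0" "K (PhiA_minus mu lam) < 0"
      unfolding plus minus K using u3 by (simp_all add: dp_def dm_def power_mult_distrib)
  qed
qed

lemma vacuum_B:
  fixes mu h :: real
  assumes "mu > 0" "h > 0"
  defines "V \<equiv> potential mu h (- (10 / 9) * h) (9 * mu ^ 4 / (10 * h))"
  shows "(\<forall>\<Phi> \<in> traceless_hermitian. V \<Phi> \<ge> 0) \<and>
    {\<Phi> \<in> traceless_hermitian. V \<Phi> = 0} = unitary_orbit (PhiB_minus mu h) \<union> unitary_orbit (PhiB_plus mu h) \<and>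
    compact (unitary_orbit (PhiB_minus mu h)) \<and> compact (unitary_orbit (PhiB_plus mu h)) \<and>
    connected (unitary_orbit (PhiB_minus mu h)) \<and> connected (unitary_orbit (PhiB_plus mu h)) \<and>
    unitary_orbit (PhiB_minus mu h) \<inter> unitary_orbit (PhiB_plus mu h) = {}"
proof -
  \<comment> \<open>The entry -4 stands at position 5, the lightest for \<open>?plus\<close>; the
    entry 4 stands at position 4, the heaviest for \<open>?minus\<close>.\<close>
  let ?plus = "($) (vector [5, 4, 3, 2, 1] :: real^5)"
  let ?minus = "($) (vector [4, 3, 2, 5, 1] :: real^5)"
  define v where "v = 3 * mu / (10 * sqrt h)"
  have v: "v > 0"
    using assms by (simp add: v_def)
  have v2: "v\<^sup>2 = 9 * mu\<^sup>2 / (100 * h)"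
    using assms by (simp add: v_def power_divide power_mult_distrib)
  \<comment> \<open>The cubic trace is -60 v^3 at the plus representative of this case, so the sign
    is reversed to make \<open>K\<close> positive there.\<close>
  define K where "K \<Phi> = - Re (trace (\<Phi> ** \<Phi> ** \<Phi>))" for \<Phi> :: "complex^5^5"
  \<comment> \<open>Here mu^2 = 100 h v^2 / 9 and the constant term is 1000 h v^4 / 9, matching the
    square centred at 20 v^2.\<close>
  have VE: "V \<Phi> = h / 18 * (13 * (Re (trace (\<Phi> ** \<Phi>)))\<^sup>2 - 20 * Re (trace (\<Phi> ** \<Phi> ** \<Phi> ** \<Phi>)))
      + 5 * h / 18 * (Re (trace (\<Phi> ** \<Phi>)) - 20 * v\<^sup>2)\<^sup>2" for \<Phi>
    unfolding V_def potential_def v2 using \<open>h > 0\<close> by (simp add: field_simps power2_eq_square power4_eq_xxxx)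
  define dp where "dp = ($) (vector [v, v, v, v, - 4 * v] :: real^5)"
  define dm where "dm = ($) (vector [- v, - v, - v, 4 * v, - v] :: real^5)"
  have plus: "PhiB_plus mu h = real_diagonal dp" and minus: "PhiB_minus mu h = real_diagonal dm"
    unfolding PhiB_plus_def PhiB_minus_def v_def[symmetric] dp_def dm_def
    by (rule real_diagonal_eq_vector[symmetric]; simp add: scaleR_conv_of_real)+
  have cases: "V B \<ge> 0"
      "V B = 0 \<Longrightarrow> f i1 = - 4 * v \<and> f i2 = v \<and> f i3 = v \<and> f i4 = v \<and> f i5 = v \<or>
        f i1 = - v \<and> f i2 = - v \<and> f i3 = - v \<and> f i4 = - v \<and> f i5 = 4 * v"
    if "B = real_diagonal f" "B \<in> traceless_hermitian"
      "f i1 \<le> f i2" "f i2 \<le> f i3" "f i3 \<le> f i4" "f i4 \<le> f i5" "distinct [i1, i2, i3, i4, i5]"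
    for B f i1 i2 i3 i4 i5
  proof -
    note univ5 = sum_distinct_5[OF that(7), unfolded sum_5]
    have sum: "f i1 + f i2 + f i3 + f i4 + f i5 = 0"
      using that(2) univ5[of f] by (simp add: that(1) real_diagonal_traceless_hermitian)
    note * = quartic_vacuum_upper[OF that(3-6) sum refl refl \<open>h > 0\<close> v]
    show "V B \<ge> 0"
      using *(1) unfolding VE that(1) real_diagonal_traces univ5[of "\<lambda>i. (f i)\<^sup>2"] univ5[of "\<lambda>i. f i ^ 4"] .
    show "V B = 0 \<Longrightarrow> f i1 = - 4 * v \<and> f i2 = v \<and> f i3 = v \<and> f i4 = v \<and> f i5 = v \<or>
        f i1 = - v \<and> f i2 = - v \<and> f i3 = - v \<and> f i4 = - v \<and> f i5 = 4 * v"
      using *(2) unfolding VE that(1) real_diagonal_traces univ5[of "\<lambda>i. (f i)\<^sup>2"] univ5[of "\<lambda>i. f i ^ 4"] .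
  qed
  have K: "K (real_diagonal f) = - (f 1 ^ 3 + f 2 ^ 3 + f 3 ^ 3 + f 4 ^ 3 + f 5 ^ 3)" for f
    by (simp add: K_def real_diagonal_traces)
  have sorted1: thesis
    if "sorted_diagonal ?plus B"
      "\<And>f. B = real_diagonal f \<Longrightarrow> f 5 \<le> f 4 \<Longrightarrow> f 4 \<le> f 3 \<Longrightarrow> f 3 \<le> f 2 \<Longrightarrow> f 2 \<le> f 1 \<Longrightarrow> thesis"
    for B thesis
    using that unfolding sorted_diagonal_def by fastforce
  have sorted2: thesis
    if "sorted_diagonal ?minus B"
      "\<And>f. B = real_diagonal f \<Longrightarrow> f 5 \<le> f 3 \<Longrightarrow> f 3 \<le> f 2 \<Longrightarrow> f 2 \<le> f 1 \<Longrightarrow> f 1 \<le> f 4 \<Longrightarrow> thesis"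
    for B thesis
    using that unfolding sorted_diagonal_def by fastforce
  have v3: "v ^ 3 > 0"
    using v by simp
  show ?thesis
  proof (rule two_orbit_vacuum[where K = K and ?w1.0 = "?plus"
      and ?w2.0 = "?minus"])
    show "V B = V A" if "B \<in> unitary_orbit A" for A B
      unfolding V_def using that by (rule potential_unitary_orbit)
    show "K B = K A" if "B \<in> unitary_orbit A" for A B
      unfolding K_def using trace_powers_unitary_orbit(2)[OF that] by simp
    show "inj ?plus" "inj ?minus"
      unfolding inj_vector_5 by simp_all
    fix B :: "complex^5^5"
    assume B: "B \<in> traceless_hermitian"
    show "V B \<ge> 0" if s: "sorted_diagonal ?plus B"
      using s
    proof (rule sorted1)
      fix f assume f: "B = real_diagonal f" "f 5 \<le> f 4" "f 4 \<le> f 3" "f 3 \<le> f 2" "f 2 \<le> f 1"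
      show ?thesis
        using cases(1)[OF f(1) B f(2-5)] by simp
    qed
    show "K B \<noteq> 0" if s: "sorted_diagonal ?plus B" and "V B = 0"
      using s
    proof (rule sorted1)
      fix f assume f: "B = real_diagonal f" "f 5 \<le> f 4" "f 4 \<le> f 3" "f 3 \<le> f 2" "f 2 \<le> f 1"
      show ?thesis
        using cases(2)[OF f(1) B f(2-5) _ \<open>V B = 0\<close>] v3 by (auto simp: f(1) K power_mult_distrib)
    qed
    show "B = PhiB_plus mu h" if s: "sorted_diagonal ?plus B" and "V B = 0" "K B > 0"
      using s
    proof (rule sorted1)
      fix f assume f: "B = real_diagonal f" "f 5 \<le> f 4" "f 4 \<le> f 3" "f 3 \<le> f 2" "f 2 \<le> f 1"
      show ?thesis
        unfolding plus f(1) using cases(2)[OF f(1) B f(2-5) _ \<open>V B = 0\<close>] v3 \<open>K B > 0\<close>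
        by (intro real_diagonal_cong) (auto simp: f(1) K dp_def power_mult_distrib)
    qed
    show "B = PhiB_minus mu h" if s: "sorted_diagonal ?minus B" and "V B = 0" "K B < 0"
      using s
    proof (rule sorted2)
      fix f assume f: "B = real_diagonal f" "f 5 \<le> f 3" "f 3 \<le> f 2" "f 2 \<le> f 1" "f 1 \<le> f 4"
      show ?thesis
        unfolding minus f(1) using cases(2)[OF f(1) B f(2-5) _ \<open>V B = 0\<close>] v3 \<open>K B < 0\<close>
        by (intro real_diagonal_cong) (auto simp: f(1) K dm_def power_mult_distrib)
    qed
  next
    show "PhiB_plus mu h \<in> traceless_hermitian" "PhiB_minus mu h \<in> traceless_hermitian"
      unfolding plus minus real_diagonal_traceless_hermitian by (simp_all add: dp_def dm_def)
    show "V (PhiB_plus mu h) = 0" "V (PhiB_minus mu h) = 0"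
      unfolding plus minus VE real_diagonal_traces by (simp_all add: dp_def dm_def power_mult_distrib flip: power_mult)
    show "K (PhiB_plus mu h) > 0" "K (PhiB_minus mu h) < 0"
      unfolding plus minus K using v3 by (simp_all add: dp_def dm_def power_mult_distrib)
  qed
qed

theorem proposition2:
  fixes mu h lam V0 :: real
  assumes "mu > 0"
  shows
    "(lam > 0 \<and> h = - (3 / 20) * lam \<and> V0 = 3 * mu ^ 4 / lam \<longrightarrow>
        (\<forall>\<Phi> \<in> (traceless_hermitian :: (complex^5^5) set). potential mu h lam V0 \<Phi> \<ge> 0) \<and>
        {\<Phi> \<in> traceless_hermitian. potential mu h lam V0 \<Phi> = 0} =
          unitary_orbit (PhiA_minus mu lam) \<union> unitary_orbit (PhiA_plus mu lam) \<and>
        compact (unitary_orbit (PhiA_minus mu lam)) \<and> compact (unitary_orbit (PhiA_plus mu lam)) \<and>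
        connected (unitary_orbit (PhiA_minus mu lam)) \<and> connected (unitary_orbit (PhiA_plus mu lam)) \<and>
        unitary_orbit (PhiA_minus mu lam) \<inter> unitary_orbit (PhiA_plus mu lam) = {}) \<and>
     (h > 0 \<and> lam = - (10 / 9) * h \<and> V0 = 9 * mu ^ 4 / (10 * h) \<longrightarrow>
        (\<forall>\<Phi> \<in> (traceless_hermitian :: (complex^5^5) set). potential mu h lam V0 \<Phi> \<ge> 0) \<and>
        {\<Phi> \<in> traceless_hermitian. potential mu h lam V0 \<Phi> = 0} =
          unitary_orbit (PhiB_minus mu h) \<union> unitary_orbit (PhiB_plus mu h) \<and>
        compact (unitary_orbit (PhiB_minus mu h)) \<and> compact (unitary_orbit (PhiB_plus mu h)) \<and>
        connected (unitary_orbit (PhiB_minus mu h)) \<and> connected (unitary_orbit (PhiB_plus mu h)) \<and>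
        unitary_orbit (PhiB_minus mu h) \<inter> unitary_orbit (PhiB_plus mu h) = {})"
  using vacuum_A vacuum_B assms by blast

end
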